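(* For every $\ell\in\mathbb N$ the curve $\Gamma_\ell^o=\Gamma_\ell\setminus\{\mu=0\}\subset\mathbb C^2_{\lambda,\mu}$ is regular (i.e. a smooth complex curve: it has no singular points).
   Context: $\mathbb N=\{1,2,3,\dots\}$. For $\ell\in\mathbb N$ let $H_\ell$ be the three-diagonal $\ell\times\ell$-matrix depending on $\mu\in\mathbb C$ with entries $H_{\ell;ij}=0$ if $|i-j|\ge 2$, $H_{\ell;jj}=(1-j)(\ell-j+1)$, $H_{\ell;j,j+1}=\mu j$, $H_{\ell;j,j-1}=\mu(\ell-j+1)$. The $\ell$-th spectral curve is $$\Gamma_\ell=\{(\lambda,\mu)\in\mathbb C^2 \mid \det(H_\ell+\lambda\operatorname{Id})=0\}\subset\mathbb C^2_{\lambda,\mu}.$$ *)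

theory Defs
  imports "HOL-Analysis.Product_Vector" "Jordan_Normal_Form.Determinant"
begin

text \<open>Rows and columns of \<open>mat\<close> are numbered from 0, those of the entries below from 1.\<close>

definition H_entry :: "nat \<Rightarrow> complex \<Rightarrow> nat \<Rightarrow> nat \<Rightarrow> complex" where
  "H_entry l \<mu> i j =
     (if i = j then (1 - of_nat j) * (of_nat l - of_nat j + 1)
      else if j = i + 1 then \<mu> * of_nat i
      else if i = j + 1 then \<mu> * (of_nat l - of_nat i + 1)
      else 0)"

definition H_mat :: "nat \<Rightarrow> complex \<Rightarrow> complex mat" where
  "H_mat l \<mu> = mat l l (\<lambda>(i, j). H_entry l \<mu> (i + 1) (j + 1))"

definition spectral_det :: "nat \<Rightarrow> complex \<times> complex \<Rightarrow> complex" where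
  "spectral_det l = (\<lambda>(lam, \<mu>). det (H_mat l \<mu> + lam \<cdot>\<^sub>m 1\<^sub>m l))"

definition spectral_curve :: "nat \<Rightarrow> (complex \<times> complex) set" where
  "spectral_curve l = {(lam, \<mu>). spectral_det l (lam, \<mu>) = 0}"

definition spectral_curve_o :: "nat \<Rightarrow> (complex \<times> complex) set" where
  "spectral_curve_o l = spectral_curve l - {(lam, \<mu>). \<mu> = 0}"

text \<open>The Frechet derivative at \<open>p\<close> exists and is complex linear; \<open>a\<close> and \<open>b\<close> are
  the two complex partial derivatives.\<close>

definition has_complex_gradient ::
  "(complex \<times> complex \<Rightarrow> complex) \<Rightarrow> complex \<times> complex \<Rightarrow> complex \<times> complex \<Rightarrow> bool" where
  "has_complex_gradient f = (\<lambda>(a, b) p. (f has_derivative (\<lambda>(h, k). a * h + b * k)) (at p))"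

definition holomorphic2_on ::
  "(complex \<times> complex \<Rightarrow> complex) \<Rightarrow> (complex \<times> complex) set \<Rightarrow> bool" where
  "holomorphic2_on f U \<longleftrightarrow> open U \<and> (\<forall>z\<in>U. \<exists>g. has_complex_gradient f g z)"

definition nonsingular_at ::
  "(complex \<times> complex \<Rightarrow> complex) \<Rightarrow> complex \<times> complex \<Rightarrow> bool" where
  "nonsingular_at f p \<longleftrightarrow> (\<exists>g. has_complex_gradient f g p \<and> g \<noteq> (0, 0))"

text \<open>A one-dimensional (not necessarily closed) complex submanifold of \<open>\<complex>\<^sup>2\<close>, in the form:
  near each of its points it is the zero set of one holomorphic function whose differential
  does not vanish at that point. The defining function may depend on the point.\<close>

definition smooth_complex_curve :: "(complex \<times> complex) set \<Rightarrow> bool" where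
  "smooth_complex_curve S \<longleftrightarrow>
     (\<forall>p\<in>S. \<exists>U f. p \<in> U \<and> holomorphic2_on f U \<and> nonsingular_at f p \<and>
        S \<inter> U = {z \<in> U. f z = 0})"

end

theory Submission
  imports Defs "HOL-Analysis.Derivative" "HOL-Computational_Algebra.Fundamental_Theorem_Algebra"
begin

text \<open>
  Identifying \<open>v\<close> with \<open>E = \<Sum> v\<^sub>j z\<^sup>j\<close>, the matrix \<open>H + \<lambda>\<close> becomes the double confluent Heun operator
  \<open>L = z\<^sup>2 D\<^sup>2 + ((1 - l) z + \<mu> (1 - z\<^sup>2)) D + (\<lambda> + \<mu> (l - 1) z)\<close> on polynomials of degree less
  than \<open>l\<close>. At a singular point of the curve, differentiating \<open>(H + \<lambda>) adj(H + \<lambda>) = det(H + \<lambda>)\<close> in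
  \<open>\<lambda>\<close> and in \<open>\<mu>\<close> yields polynomials \<open>E\<close>, \<open>u\<close>, \<open>w\<close> of degree less than \<open>l\<close> with \<open>L E = 0\<close>, \<open>L u = - E\<close>
  and \<open>L w = - (\<partial>L/\<partial>\<mu>) E\<close>. The polynomial \<open>E\<close> has \<open>l - 1\<close> simple nonzero roots \<open>a\<close>. In the basis
  \<open>E / (z - a)\<close>, and after dividing by \<open>z\<^sup>2 E'\<close>, evaluation of \<open>L\<close> at the roots has the symmetric
  off-diagonal entries \<open>- 2 / (b - a)\<^sup>2\<close>. Symmetry applied to \<open>u\<close> and \<open>w\<close> gives
  \<open>\<Sum> c\<^sub>a (1 - 1 / a\<^sup>2) = 0\<close> for the coordinates \<open>c\<^sub>a = u(a) / E'(a)\<close>, whereas the leading and the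
  constant coefficients of \<open>L u = - E\<close> give \<open>\<Sum> c\<^sub>a = - 1 / \<mu>\<close> and \<open>\<Sum> c\<^sub>a / a\<^sup>2 = 1 / \<mu>\<close>.
\<close>

section \<open>The double confluent Heun operator on polynomials\<close>

definition heun :: "nat \<Rightarrow> complex \<Rightarrow> complex \<Rightarrow> complex poly \<Rightarrow> complex poly" where
  "heun l lam \<mu> p = [:0, 0, 1:] * pderiv (pderiv p) + [:\<mu>, 1 - of_nat l, - \<mu>:] * pderiv p
     + [:lam, \<mu> * (of_nat l - 1):] * p"

text \<open>The \<open>\<mu>\<close>-derivative of \<open>heun\<close>.\<close>

definition heun_mu :: "nat \<Rightarrow> complex poly \<Rightarrow> complex poly" where
  "heun_mu l p = [:1, 0, - 1:] * pderiv p + [:0, of_nat l - 1:] * p"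

lemma poly_heun:
  "poly (heun l lam \<mu> p) z = z\<^sup>2 * poly (pderiv (pderiv p)) z
     + (\<mu> + (1 - of_nat l) * z - \<mu> * z\<^sup>2) * poly (pderiv p) z
     + (lam + \<mu> * (of_nat l - 1) * z) * poly p z"
  by (simp add: heun_def algebra_simps power2_eq_square)

lemma heun_add: "heun l lam \<mu> (p + q) = heun l lam \<mu> p + heun l lam \<mu> q"
  unfolding heun_def pderiv_add distrib_left by (simp only: add_ac)

lemma heun_smult: "heun l lam \<mu> (smult c p) = smult c (heun l lam \<mu> p)"
  by (simp add: heun_def pderiv_smult smult_add_right)

lemma heun_0: "heun l lam \<mu> 0 = 0"
  by (simp add: heun_def)

lemma heun_sum: "heun l lam \<mu> (sum f A) = (\<Sum>a\<in>A. heun l lam \<mu> (f a))"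
  by (induction A rule: infinite_finite_induct) (auto simp: heun_0 heun_add)

text \<open>With \<lambda> for \<open>lam\<close>, this is row \<open>k\<close>, counted from 0, of
  H + \<lambda> applied to the coefficient vector of \<open>p\<close>; \<open>coeff_heun_mu\<close>
  plays the same role for the \<mu>-derivative of the matrix.\<close>

lemma coeff_heun:
  "coeff (heun l lam \<mu> p) k =
     ((of_nat k * of_nat k - of_nat l * of_nat k) + lam) * coeff p k
     + \<mu> * of_nat (Suc k) * coeff p (Suc k)
     + (case k of 0 \<Rightarrow> 0 | Suc j \<Rightarrow> \<mu> * (of_nat l - of_nat k) * coeff p j)"
proof (cases k)
  case 0
  then show ?thesis by (simp add: heun_def coeff_pderiv)
next
  case k: (Suc j)
  then show ?thesis
    by (cases j) (simp_all add: heun_def coeff_pderiv algebra_simps)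
qed

lemma coeff_heun_mu:
  "coeff (heun_mu l p) k = of_nat (Suc k) * coeff p (Suc k)
     + (case k of 0 \<Rightarrow> 0 | Suc j \<Rightarrow> (of_nat l - of_nat k) * coeff p j)"
proof (cases k)
  case 0
  then show ?thesis by (simp add: heun_mu_def coeff_pderiv)
next
  case k: (Suc j)
  then show ?thesis
    by (cases j) (simp_all add: heun_mu_def coeff_pderiv algebra_simps)
qed

text \<open>Multiplication by z could push degree \<open>l - 1\<close> up to \<open>l\<close>, but
  the factor \<open>l - k\<close> in front of that term is zero at \<open>k = l\<close>. So
  polynomials of degree below \<open>l\<close> are preserved.\<close>

lemma coeff_heun_eq_0:
  assumes "\<And>k. k \<ge> l \<Longrightarrow> coeff p k = 0" "k \<ge> l"
  shows "coeff (heun l lam \<mu> p) k = 0" "coeff (heun_mu l p) k = 0"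
proof -
  have "(of_nat l - of_nat (Suc j) :: complex) * coeff p j = 0" if "k = Suc j" for j
    using assms that by (cases "l = Suc j") auto
  then show "coeff (heun l lam \<mu> p) k = 0" "coeff (heun_mu l p) k = 0"
    using assms by (auto simp: coeff_heun coeff_heun_mu mult.assoc split: nat.splits)
qed

section \<open>Polynomial solutions of the Heun equation\<close>

text \<open>Away from 0 the leading coefficient z^2 does not vanish. At a multiple root
  \<open>a\<close>, let \<open>m\<close> be the order of p'. The equation expresses z^2 p'' through
  p' and p, so p'' vanishes to order at least \<open>m\<close>, whereas its order is
  \<open>m - 1\<close>.\<close>

lemma heun_kernel_rsquarefree:
  assumes "heun l lam \<mu> p = 0" "poly p 0 \<noteq> 0"
  shows "rsquarefree p"
  unfolding rsquarefree_roots
proof (intro allI notI)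
  fix a assume a: "poly p a = 0 \<and> poly (pderiv p) a = 0"
  have "a \<noteq> 0" using a assms(2) by auto
  have p0: "p \<noteq> 0" using assms(2) by auto
  have p1: "pderiv p \<noteq> 0"
  proof
    assume "pderiv p = 0"
    then obtain c where "p = [:c:]"
      by (metis pderiv_eq_0_iff degree_eq_zeroE)
    then show False using a p0 by auto
  qed
  have o1: "order a p = Suc (order a (pderiv p))" using order_pderiv p0 a by blast
  have o2: "order a (pderiv p) = Suc (order a (pderiv (pderiv p)))"
    using order_pderiv p1 a by blast
  define m where "m = order a (pderiv p)"
  let ?d = "[:-a, 1:] ^ m"
  have "?d dvd pderiv p" unfolding m_def by (rule order_1)
  moreover have "?d dvd p" using order_1[of a p] unfolding o1 m_def
    by (rule power_le_dvd) simp
  ultimately have "?d dvd heun l lam \<mu> p - [:\<mu>, 1 - of_nat l, - \<mu>:] * pderiv p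
     - [:lam, \<mu> * (of_nat l - 1):] * p"
    unfolding assms(1) by (intro dvd_diff dvd_mult) auto
  then have "?d dvd [:0, 0, 1:] * pderiv (pderiv p)"
    by (simp add: heun_def)
  moreover have p2: "pderiv (pderiv p) \<noteq> 0"
  proof
    assume "pderiv (pderiv p) = 0"
    then obtain c where "pderiv p = [:c:]"
      by (metis pderiv_eq_0_iff degree_eq_zeroE)
    then show False using a p1 by auto
  qed
  then have nz: "[:0, 0, 1:] * pderiv (pderiv p) \<noteq> 0" by simp
  ultimately have "m \<le> order a ([:0, 0, 1:] * pderiv (pderiv p))"
    by (simp add: order_divides)
  also have "\<dots> = order a [:0, 0, 1:] + order a (pderiv (pderiv p))"
    using order_mult nz by blast
  also have "order a [:0, 0, 1:] = 0"
    using \<open>a \<noteq> 0\<close> by (intro order_0I) simp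
  finally show False using o2 unfolding m_def by simp
qed

text \<open>In degree \<open>degree p + 1\<close> only the term coming from the leading coefficient
  survives, and its factor \<mu> (l - degree p - 1) vanishes only for
  \<open>degree p = l - 1\<close>.\<close>

lemma heun_kernel_degree:
  assumes "heun l lam \<mu> p = 0" "p \<noteq> 0" "\<mu> \<noteq> 0" "\<And>k. k \<ge> l \<Longrightarrow> coeff p k = 0" "l \<ge> 1"
  shows "degree p = l - 1"
proof (rule ccontr)
  assume "degree p \<noteq> l - 1"
  moreover have "degree p < l"
    using assms(2,4) by (metis leading_coeff_0_iff not_le)
  ultimately have d: "Suc (degree p) < l" by linarith
  have "coeff (heun l lam \<mu> p) (Suc (degree p)) = 0" using assms(1) by simp
  then have "\<mu> * (of_nat l - of_nat (Suc (degree p))) * lead_coeff p = 0"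
    by (simp add: coeff_heun coeff_eq_0)
  then show False using assms(2,3) d by (simp del: of_nat_Suc)
qed

section \<open>Contradiction at a singular point, in terms of polynomials\<close>

text \<open>Here \<open>E\<close> stands for a kernel vector of H + \<lambda> at a supposed singular
  point, and \<open>u\<close>, \<open>w\<close> for its derivatives in \<lambda> and \<mu>.\<close>

lemma heun_deriv_kernel_contradiction:
  fixes E u w :: "complex poly"
  assumes \<mu>: "\<mu> \<noteq> 0" and l: "l \<ge> 1"
    and E: "heun l lam \<mu> E = 0" "poly E 0 \<noteq> 0" "\<And>k. k \<ge> l \<Longrightarrow> coeff E k = 0"
    and u: "heun l lam \<mu> u = - E" "\<And>k. k \<ge> l \<Longrightarrow> coeff u k = 0"
    and w: "heun l lam \<mu> w = - heun_mu l E" "\<And>k. k \<ge> l \<Longrightarrow> coeff w k = 0"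
  shows False
proof -
  have E0: "E \<noteq> 0" using E(2) by auto
  have deg: "degree E = l - 1" using heun_kernel_degree[OF E(1) E0 \<mu> E(3) l] .
  have sqf: "rsquarefree E" using heun_kernel_rsquarefree E by blast
  define Z where "Z = {z. poly E z = 0}"
  have finZ: "finite Z" unfolding Z_def using E0 poly_roots_finite by blast
  have Z0: "z \<noteq> 0" if "z \<in> Z" for z using that E(2) Z_def by auto
  have E': "poly (pderiv E) z \<noteq> 0" if "z \<in> Z" for z
    using sqf that unfolding rsquarefree_roots Z_def by auto
  define c where "c = lead_coeff E"
  have c0: "c \<noteq> 0" using E0 c_def by simp
  have dec: "smult c (\<Prod>z\<in>Z. [:-z, 1:]) = E"
    unfolding c_def Z_def by (rule complex_poly_decompose_rsquarefree[OF sqf])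
  have cardZ: "card Z = l - 1"
  proof -
    have "degree E = degree (\<Prod>z\<in>Z. [:-z, 1:])"
      using dec c0 by (metis degree_smult_eq)
    also have "\<dots> = card Z" by (subst degree_prod_eq_sum_degree) auto
    finally show ?thesis using deg by simp
  qed
  \<comment> \<open>Up to scaling, the \<open>q a\<close> are the Lagrange basis for the nodes
    \<open>Z\<close>: \<open>q a\<close> vanishes at every root except \<open>a\<close>.\<close>
  define q where "q a = E div [:-a, 1:]" for a
  have qE: "E = [:-a, 1:] * q a" if "a \<in> Z" for a
    using that unfolding q_def Z_def by (metis dvd_mult_div_cancel mem_Collect_eq poly_eq_0_iff_dvd)
  have q_eval: "poly E z = (z - a) * poly (q a) z" if "a \<in> Z" for a z
    using arg_cong[OF qE[OF that], of "\<lambda>p. poly p z"] by (simp add: algebra_simps)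
  have dE: "pderiv E = q a + [:-a, 1:] * pderiv (q a)" if "a \<in> Z" for a
    by (subst qE[OF that], subst pderiv_mult) (simp add: pderiv_pCons)
  have q_eval1: "poly (pderiv E) z = poly (q a) z + (z - a) * poly (pderiv (q a)) z"
    if "a \<in> Z" for a z
    using arg_cong[OF dE[OF that], of "\<lambda>p. poly p z"] by (simp add: algebra_simps)
  have ddE: "pderiv (pderiv E) = 2 * pderiv (q a) + [:-a, 1:] * pderiv (pderiv (q a))"
    if "a \<in> Z" for a
    by (subst dE[OF that], subst pderiv_add, subst pderiv_mult) (simp add: pderiv_pCons)
  have q_eval2: "poly (pderiv (pderiv E)) z
      = 2 * poly (pderiv (q a)) z + (z - a) * poly (pderiv (pderiv (q a))) z"
    if "a \<in> Z" for a z
    using arg_cong[OF ddE[OF that], of "\<lambda>p. poly p z"] by (simp add: algebra_simps)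
  have degq: "degree E = Suc (degree (q a))" if "a \<in> Z" for a
  proof -
    have "q a \<noteq> 0" using qE[OF that] E0 by auto
    then show ?thesis by (subst qE[OF that]) (simp add: degree_mult_eq del: mult_pCons_left)
  qed
  have lead_q: "coeff (q a) (l - 2) = c" if "a \<in> Z" for a
  proof -
    have "lead_coeff E = lead_coeff (q a)"
      by (subst (1 2) qE[OF that]) (simp add: lead_coeff_mult del: mult_pCons_left)
    then show ?thesis using degq[OF that] deg by (simp add: c_def diff_Suc numeral_2_eq_2 split: nat.splits)
  qed
  have q_coeff_0: "coeff (q a) k = 0" if "a \<in> Z" "k \<ge> l - 1" for a k
    using degq[OF that(1)] deg that(2) by (intro coeff_eq_0) simp

  have qaa: "poly (q a) a = poly (pderiv E) a" if "a \<in> Z" for a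
    using q_eval1[OF that, of a] by simp
  have qab: "poly (q a) b = 0" if "a \<in> Z" "b \<in> Z" "b \<noteq> a" for a b
    using q_eval[OF that(1), of b] that(2,3) unfolding Z_def by simp

  define G where "G a b = poly (heun l lam \<mu> (q a)) b / (b\<^sup>2 * poly (pderiv E) b)" for a b
  \<comment> \<open>The derivatives of E = (z - a) q at \<open>b\<close>, where q vanishes, are E' =
    (b - a) q' and E'' = 2 q' + (b - a) q''. Inserting them into
    \<open>heun l lam \<mu> E = 0\<close> at \<open>b\<close> determines the value of
    \<open>heun\<close> on \<open>q a\<close>.\<close>
  have G: "G a b = - 2 / (b - a)\<^sup>2" if ab: "a \<in> Z" "b \<in> Z" "b \<noteq> a" for a b
  proof -
    define e where "e = poly (pderiv E) b"
    define e1 where "e1 = poly (pderiv (q a)) b"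
    define e2 where "e2 = poly (pderiv (pderiv (q a))) b"
    have 1: "e = (b - a) * e1"
      using q_eval1[OF ab(1), of b] qab[OF ab] by (simp add: e_def e1_def)
    have "poly (heun l lam \<mu> E) b = 0" using E(1) by simp
    then have 2: "b\<^sup>2 * (2 * e1 + (b - a) * e2) + (\<mu> + (1 - of_nat l) * b - \<mu> * b\<^sup>2) * e = 0"
      using q_eval2[OF ab(1), of b] ab(2) by (simp add: poly_heun e_def e1_def e2_def Z_def)
    define K where "K = \<mu> + (1 - of_nat l) * b - \<mu> * b\<^sup>2"
    have 4: "poly (heun l lam \<mu> (q a)) b = b\<^sup>2 * e2 + K * e1"
      unfolding poly_heun qab[OF ab] e1_def e2_def K_def by simp
    have "(b - a) * (b\<^sup>2 * e2 + K * e1) + 2 * b\<^sup>2 * e1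
        = b\<^sup>2 * (2 * e1 + (b - a) * e2) + K * ((b - a) * e1)"
      by (simp add: algebra_simps)
    also have "\<dots> = 0" using 2 unfolding 1 K_def .
    finally have "(b - a) * poly (heun l lam \<mu> (q a)) b = - 2 * b\<^sup>2 * e1"
      unfolding 4 by (simp add: eq_neg_iff_add_eq_0)
    from arg_cong[OF this, of "(*) (b - a)"]
    have 3: "(b - a)\<^sup>2 * poly (heun l lam \<mu> (q a)) b = - 2 * b\<^sup>2 * e"
      unfolding 1 by (simp add: power2_eq_square mult_ac)
    have "e \<noteq> 0" "b \<noteq> 0" using E' Z0 ab(2) e_def by auto
    then show ?thesis using 3 ab(3) unfolding G_def e_def[symmetric]
      by (simp add: divide_simps) (simp add: mult_ac)
  qed
  have Gsym: "G a b = G b a" if "a \<in> Z" "b \<in> Z" for a b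
    using G[of a b] G[of b a] that by (cases "a = b") (simp_all add: power2_commute)

  define cf where "cf v a = poly v a / poly (pderiv E) a" for v a
  define \<alpha> where "\<alpha> v = coeff v (l - 1) / c" for v
  \<comment> \<open>Subtracting \<alpha> E removes the coefficient of degree \<open>l - 1\<close>
    without changing values on \<open>Z\<close>. The remainder has degree below
    \<open>l - 1 = card Z\<close>, so Lagrange interpolation recovers it.\<close>
  have interp: "v - smult (\<alpha> v) E = (\<Sum>a\<in>Z. smult (cf v a) (q a))"
    if v: "\<And>k. k \<ge> l \<Longrightarrow> coeff v k = 0" for v
  proof (rule ccontr)
    define d where "d = v - smult (\<alpha> v) E - (\<Sum>a\<in>Z. smult (cf v a) (q a))"
    assume "\<not> ?thesis"
    then have d0: "d \<noteq> 0" by (simp add: d_def)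
    have "coeff d k = 0" if k: "k \<ge> l - 1" for k
    proof -
      have "coeff v k - \<alpha> v * coeff E k = 0"
      proof (cases "k = l - 1")
        case True
        then show ?thesis using c0 deg by (simp add: \<alpha>_def c_def)
      next
        case False
        then show ?thesis using k v E(3) by simp
      qed
      then show ?thesis using q_coeff_0 k by (simp add: d_def coeff_sum)
    qed
    then have dd: "degree d < l - 1"
      using d0 by (metis leading_coeff_0_iff not_le)
    have "poly d b = 0" if "b \<in> Z" for b
    proof -
      have "(\<Sum>a\<in>Z. cf v a * poly (q a) b) = (\<Sum>a\<in>Z. if a = b then poly v b else 0)"
        using qab that qaa E' by (intro sum.cong) (auto simp: cf_def)
      also have "\<dots> = poly v b" using finZ that by simp
      finally show ?thesis using that by (simp add: d_def poly_sum Z_def)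
    qed
    then have "card Z \<le> card {x. poly d x = 0}"
      using d0 poly_roots_finite by (intro card_mono) auto
    also have "\<dots> \<le> degree d" by (rule card_poly_roots_bound[OF d0])
    finally show False using dd cardZ by simp
  qed
  have heun_interp: "heun l lam \<mu> v = (\<Sum>a\<in>Z. smult (cf v a) (heun l lam \<mu> (q a)))"
    if "\<And>k. k \<ge> l \<Longrightarrow> coeff v k = 0" for v
  proof -
    have "v = smult (\<alpha> v) E + (\<Sum>a\<in>Z. smult (cf v a) (q a))"
      using interp[OF that] by (simp add: algebra_simps)
    then have "heun l lam \<mu> v
        = heun l lam \<mu> (smult (\<alpha> v) E + (\<Sum>a\<in>Z. smult (cf v a) (q a)))" by simp
    then show ?thesis by (simp add: heun_add heun_smult heun_sum E(1))
  qed

  \<comment> \<open>Since \<open>q a\<close> has degree \<open>l - 2\<close>, the coefficient in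
    degree \<open>l - 1\<close> comes only from the raising term, whose factor is \<mu> (l - (l -
    1)) = \<mu>.\<close>
  have lead_heun_q: "coeff (heun l lam \<mu> (q a)) (l - 1) = \<mu> * c" if a: "a \<in> Z" for a
  proof -
    from a have "card Z \<noteq> 0" using finZ by auto
    then have "l \<ge> 2" using cardZ by simp
    then obtain m where m: "l = Suc (Suc m)" by (auto simp: le_iff_add)
    show ?thesis
      using q_coeff_0[OF a, of "Suc m"] q_coeff_0[OF a, of "Suc (Suc m)"] lead_q[OF a] m
      by (simp add: coeff_heun)
  qed
  \<comment> \<open>Comparing leading coefficients in
    \<open>heun l lam \<mu> u = - E\<close>.\<close>
  have "coeff (heun l lam \<mu> u) (l - 1) = (\<Sum>a\<in>Z. cf u a * (\<mu> * c))"
    using heun_interp[of u] u(2) by (simp add: coeff_sum lead_heun_q del: One_nat_def)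
  then have "(\<Sum>a\<in>Z. cf u a) * (\<mu> * c) = - c"
    unfolding u(1) using deg by (simp add: c_def sum_distrib_right)
  then have sum1: "(\<Sum>a\<in>Z. cf u a) * \<mu> = - 1"
    using c0 by (metis (no_types, opaque_lifting) mult.assoc mult_cancel_right mult_minus1)

  \<comment> \<open>At z = 0 the equation for \<open>E\<close> reads \<mu> E'(0) + \<lambda> E(0) =
    0; substituting E = (z - a) q yields the value for q.\<close>
  have heun_q_0: "poly (heun l lam \<mu> (q a)) 0 = - \<mu> * poly E 0 / a\<^sup>2" if a: "a \<in> Z" for a
  proof -
    have 1: "poly E 0 = - a * poly (q a) 0" using q_eval[OF a, of 0] by simp
    have 2: "poly (pderiv E) 0 = poly (q a) 0 - a * poly (pderiv (q a)) 0"
      using q_eval1[OF a, of 0] by simp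
    have "poly (heun l lam \<mu> E) 0 = 0" using E(1) by simp
    then have "\<mu> * poly (pderiv E) 0 + lam * poly E 0 = 0" by (simp add: poly_heun)
    then have "a * (\<mu> * poly (pderiv (q a)) 0 + lam * poly (q a) 0) = \<mu> * poly (q a) 0"
      unfolding 1 2 by (simp add: algebra_simps)
    then have "a * poly (heun l lam \<mu> (q a)) 0 = \<mu> * poly (q a) 0"
      by (simp add: poly_heun)
    then show ?thesis
      unfolding 1 using Z0[OF a] by (simp add: field_simps power2_eq_square)
  qed
  \<comment> \<open>Comparing constant coefficients in
    \<open>heun l lam \<mu> u = - E\<close>.\<close>
  have "poly (heun l lam \<mu> u) 0 = (\<Sum>a\<in>Z. cf u a * (- \<mu> * poly E 0 / a\<^sup>2))"
    using heun_interp[of u] u(2) by (simp add: poly_sum heun_q_0)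
  also have "\<dots> = - \<mu> * poly E 0 * (\<Sum>a\<in>Z. cf u a / a\<^sup>2)"
    by (simp add: sum_distrib_left mult_ac)
  finally have "poly E 0 * (\<mu> * (\<Sum>a\<in>Z. cf u a / a\<^sup>2)) = poly E 0 * 1"
    unfolding u(1) by (simp add: mult_ac)
  then have sum2: "\<mu> * (\<Sum>a\<in>Z. cf u a / a\<^sup>2) = 1"
    using E(2) by (simp only: mult_cancel_left) simp

  have val: "poly (heun l lam \<mu> v) b / (b\<^sup>2 * poly (pderiv E) b) = (\<Sum>a\<in>Z. cf v a * G a b)"
    if "\<And>k. k \<ge> l \<Longrightarrow> coeff v k = 0" for v b
    using heun_interp[of v] that by (simp add: poly_sum G_def sum_divide_distrib)
  have valw: "poly (heun l lam \<mu> w) b / (b\<^sup>2 * poly (pderiv E) b) = (\<Sum>a\<in>Z. cf w a * G a b)"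
    and valu: "poly (heun l lam \<mu> u) b / (b\<^sup>2 * poly (pderiv E) b) = (\<Sum>a\<in>Z. cf u a * G a b)" for b
    using val w(2) u(2) by blast+
  \<comment> \<open>Symmetry of \<open>G\<close> moves the operator from \<open>w\<close> to
    \<open>u\<close>, and \<open>heun l lam \<mu> u = - E\<close> vanishes on
    \<open>Z\<close>.\<close>
  have "(\<Sum>b\<in>Z. cf u b * (poly (heun l lam \<mu> w) b / (b\<^sup>2 * poly (pderiv E) b)))
      = (\<Sum>b\<in>Z. \<Sum>a\<in>Z. cf u b * cf w a * G a b)"
    unfolding valw sum_distrib_left by (simp add: mult.assoc)
  also have "\<dots> = (\<Sum>a\<in>Z. \<Sum>b\<in>Z. cf u b * cf w a * G a b)"
    by (rule sum.swap)
  also have "\<dots> = (\<Sum>a\<in>Z. cf w a * (\<Sum>b\<in>Z. cf u b * G b a))"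
    unfolding sum_distrib_left using Gsym by (intro sum.cong refl) (simp add: mult_ac)
  also have "\<dots> = (\<Sum>a\<in>Z. cf w a * (poly (heun l lam \<mu> u) a / (a\<^sup>2 * poly (pderiv E) a)))"
    unfolding valu ..
  also have "\<dots> = 0" unfolding u(1) by (simp add: Z_def)
  finally have "(\<Sum>b\<in>Z. cf u b * (poly (heun l lam \<mu> w) b / (b\<^sup>2 * poly (pderiv E) b))) = 0" .
  moreover have "poly (heun l lam \<mu> w) b / (b\<^sup>2 * poly (pderiv E) b) = 1 - 1 / b\<^sup>2"
    if b: "b \<in> Z" for b
  proof -
    have "poly E b = 0" using b by (simp add: Z_def)
    then have "poly (heun l lam \<mu> w) b = (b\<^sup>2 - 1) * poly (pderiv E) b"
      unfolding w(1) heun_mu_def by (simp add: algebra_simps power2_eq_square)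
    then show ?thesis using E'[OF b] Z0[OF b] by (simp add: field_simps)
  qed
  ultimately have "(\<Sum>b\<in>Z. cf u b * (1 - 1 / b\<^sup>2)) = 0" by simp
  then have "(\<Sum>b\<in>Z. cf u b) = (\<Sum>b\<in>Z. cf u b / b\<^sup>2)"
    by (simp add: right_diff_distrib sum_subtractf)
  \<comment> \<open>One and the same sum, multiplied by \<mu>, would equal both -1 and 1.\<close>
  then show False using sum1 sum2 by (simp add: mult.commute)
qed

section \<open>Complex differentiability in two variables\<close>

lemma has_complex_gradientD:
  assumes "has_complex_gradient f (a, b) (x, y)"
  shows "((\<lambda>t. f (t, y)) has_field_derivative a) (at x)"
    and "((\<lambda>t. f (x, t)) has_field_derivative b) (at y)"
proof -
  have f: "(f has_derivative (\<lambda>(h, k). a * h + b * k)) (at (x, y))"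
    using assms by (simp add: has_complex_gradient_def)
  have "((\<lambda>t. (t, y)) has_derivative (\<lambda>h. (h, 0))) (at x)"
    by (intro derivative_eq_intros) auto
  from has_derivative_compose[OF this, of f "\<lambda>(h, k). a * h + b * k"] f
  show "((\<lambda>t. f (t, y)) has_field_derivative a) (at x)"
    by (simp add: has_field_derivative_def)
  have "((\<lambda>t. (x, t)) has_derivative (\<lambda>h. (0, h))) (at y)"
    by (intro derivative_eq_intros) auto
  from has_derivative_compose[OF this, of f "\<lambda>(h, k). a * h + b * k"] f
  show "((\<lambda>t. f (x, t)) has_field_derivative b) (at y)"
    by (simp add: has_field_derivative_def)
qed

text \<open>Only the existence of a gradient is recorded. Closure under sums and products then
  covers determinants and cofactors without computing their derivatives.\<close>

definition complex_differentiable2 :: "(complex \<times> complex \<Rightarrow> complex) \<Rightarrow> complex \<times> complex \<Rightarrow> bool"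
  where "complex_differentiable2 f p \<longleftrightarrow> (\<exists>g. has_complex_gradient f g p)"

lemma complex_differentiable2_const: "complex_differentiable2 (\<lambda>z. c) p"
  unfolding complex_differentiable2_def has_complex_gradient_def
  by (intro exI[of _ "(0, 0)"]) (auto intro!: derivative_eq_intros)

lemma complex_differentiable2_fst: "complex_differentiable2 fst p"
  unfolding complex_differentiable2_def has_complex_gradient_def
  by (intro exI[of _ "(1, 0)"]) (auto intro!: derivative_eq_intros)

lemma complex_differentiable2_snd: "complex_differentiable2 snd p"
  unfolding complex_differentiable2_def has_complex_gradient_def
  by (intro exI[of _ "(0, 1)"]) (auto intro!: derivative_eq_intros)

lemma complex_differentiable2_add:
  assumes "complex_differentiable2 f p" "complex_differentiable2 g p"
  shows "complex_differentiable2 (\<lambda>z. f z + g z) p"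
proof -
  obtain a b a' b' where
    "(f has_derivative (\<lambda>(h, k). a * h + b * k)) (at p)"
    "(g has_derivative (\<lambda>(h, k). a' * h + b' * k)) (at p)"
    using assms unfolding complex_differentiable2_def has_complex_gradient_def by auto
  from has_derivative_add[OF this]
  have "((\<lambda>z. f z + g z) has_derivative (\<lambda>(h, k). (a + a') * h + (b + b') * k)) (at p)"
    by (rule has_derivative_eq_rhs) (auto simp: fun_eq_iff algebra_simps)
  then show ?thesis
    unfolding complex_differentiable2_def has_complex_gradient_def by auto
qed

lemma complex_differentiable2_mult:
  assumes "complex_differentiable2 f p" "complex_differentiable2 g p"
  shows "complex_differentiable2 (\<lambda>z. f z * g z) p"
proof -
  obtain a b a' b' where
    "(f has_derivative (\<lambda>(h, k). a * h + b * k)) (at p)"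
    "(g has_derivative (\<lambda>(h, k). a' * h + b' * k)) (at p)"
    using assms unfolding complex_differentiable2_def has_complex_gradient_def by auto
  from has_derivative_mult[OF this]
  have "((\<lambda>z. f z * g z) has_derivative
      (\<lambda>(h, k). (f p * a' + a * g p) * h + (f p * b' + b * g p) * k)) (at p)"
    by (rule has_derivative_eq_rhs) (auto simp: fun_eq_iff algebra_simps)
  then show ?thesis
    unfolding complex_differentiable2_def has_complex_gradient_def by auto
qed

lemma complex_differentiable2_sum:
  "(\<And>i. i \<in> I \<Longrightarrow> complex_differentiable2 (f i) p) \<Longrightarrow> complex_differentiable2 (\<lambda>z. \<Sum>i\<in>I. f i z) p"
  by (induction I rule: infinite_finite_induct)
    (auto intro: complex_differentiable2_const complex_differentiable2_add)

lemma complex_differentiable2_prod: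
  "(\<And>i. i \<in> I \<Longrightarrow> complex_differentiable2 (f i) p) \<Longrightarrow> complex_differentiable2 (\<lambda>z. \<Prod>i\<in>I. f i z) p"
  by (induction I rule: infinite_finite_induct)
    (auto intro: complex_differentiable2_const complex_differentiable2_mult)

lemma complex_differentiable2_det:
  assumes A: "\<And>z. A z \<in> carrier_mat n n"
    and "\<And>i j. i < n \<Longrightarrow> j < n \<Longrightarrow> complex_differentiable2 (\<lambda>z. A z $$ (i, j)) p"
  shows "complex_differentiable2 (\<lambda>z. det (A z)) p"
  unfolding det_def'[OF A]
proof (intro complex_differentiable2_sum complex_differentiable2_mult
    complex_differentiable2_const complex_differentiable2_prod)
  fix \<pi> i assume "\<pi> \<in> {\<pi>. \<pi> permutes {0..<n}}" "i \<in> {0..<n}"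
  then show "complex_differentiable2 (\<lambda>z. A z $$ (i, \<pi> i)) p"
    using assms(2)[of i "\<pi> i"] permutes_in_image[of \<pi> "{0..<n}" i] by simp
qed

lemma complex_differentiable2_cofactor:
  assumes A: "\<And>z. A z \<in> carrier_mat n n"
    and "\<And>i j. i < n \<Longrightarrow> j < n \<Longrightarrow> complex_differentiable2 (\<lambda>z. A z $$ (i, j)) p"
  shows "complex_differentiable2 (\<lambda>z. cofactor (A z) k m) p"
  unfolding cofactor_def
proof (intro complex_differentiable2_mult complex_differentiable2_const
    complex_differentiable2_det[where n = "n - 1"])
  show "mat_delete (A z) k m \<in> carrier_mat (n - 1) (n - 1)" for z
    using A[of z] by (simp add: mat_delete_def)
  show "complex_differentiable2 (\<lambda>z. mat_delete (A z) k m $$ (i, j)) p"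
    if "i < n - 1" "j < n - 1" for i j
    using A that by (simp add: mat_delete_def carrier_matD[OF A]) (intro conjI impI assms(2); simp)
qed

text \<open>Differentiating \<open>A adj(A) = det(A) 1\<close> where \<open>det A\<close> vanishes to first order.\<close>

lemma deriv_mat_times_cofactor:
  fixes A :: "complex \<Rightarrow> complex mat"
  assumes A: "\<And>t. A t \<in> carrier_mat n n"
    and dA: "\<And>i j. i < n \<Longrightarrow> j < n \<Longrightarrow> ((\<lambda>t. A t $$ (i, j)) has_field_derivative D i j) (at x)"
    and dC: "\<And>j. j < n \<Longrightarrow> ((\<lambda>t. cofactor (A t) k j) has_field_derivative C j) (at x)"
    and det: "((\<lambda>t. det (A t)) has_field_derivative 0) (at x)"
    and k: "k < n" and i: "i < n"
  shows "(\<Sum>j<n. A x $$ (i, j) * C j) = - (\<Sum>j<n. D i j * cofactor (A x) k j)"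
proof -
  \<comment> \<open>This is entry \<open>(i, k)\<close> of A adj(A): column \<open>k\<close> of the
    adjugate consists of the cofactors along row \<open>k\<close>.\<close>
  have eq: "(\<Sum>j<n. A t $$ (i, j) * cofactor (A t) k j) = (if i = k then det (A t) else 0)" for t
  proof -
    have "(A t * adj_mat (A t)) $$ (i, k) = (\<Sum>j<n. A t $$ (i, j) * cofactor (A t) k j)"
      using A[of t] i k
      by (simp add: scalar_prod_def adj_mat_def lessThan_atLeast0)
    then show ?thesis using adj_mat(2)[OF A[of t]] i k by auto
  qed
  have "((\<lambda>t. if i = k then det (A t) else 0) has_field_derivative 0) (at x)"
    using det by (cases "i = k") auto
  moreover have "((\<lambda>t. \<Sum>j<n. A t $$ (i, j) * cofactor (A t) k j) has_field_derivative
     (\<Sum>j<n. A x $$ (i, j) * C j + D i j * cofactor (A x) k j)) (at x)"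
    using dA[OF i] dC by (intro DERIV_sum DERIV_mult') auto
  ultimately have "(\<Sum>j<n. A x $$ (i, j) * C j + D i j * cofactor (A x) k j) = 0"
    unfolding eq by (rule DERIV_unique[THEN sym])
  then show ?thesis by (simp add: sum.distrib eq_neg_iff_add_eq_0)
qed

section \<open>The matrix H + \<lambda> as the Heun operator\<close>

definition char_mat :: "nat \<Rightarrow> complex \<times> complex \<Rightarrow> complex mat" where
  "char_mat l = (\<lambda>(lam, \<mu>). H_mat l \<mu> + lam \<cdot>\<^sub>m 1\<^sub>m l)"

lemma char_mat_carrier: "char_mat l z \<in> carrier_mat l l"
  by (simp add: char_mat_def H_mat_def split: prod.splits)

text \<open>Passing to indices from 0 substitutes \<open>i + 1\<close> for the row number, so that
  (1 - j)(l - j + 1) becomes -i (l - i) on the diagonal.\<close>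

lemma char_mat_entry:
  assumes "i < l" "j < l"
  shows "char_mat l z $$ (i, j) =
    (if i = j then of_nat i * of_nat i - of_nat l * of_nat i + fst z
     else if j = Suc i then snd z * of_nat (Suc i)
     else if i = Suc j then snd z * (of_nat l - of_nat i) else 0)"
  using assms by (auto simp: char_mat_def H_mat_def H_entry_def algebra_simps split: prod.splits)

lemma tridiagonal_row_sum:
  fixes p :: "complex poly"
  assumes "\<And>k. k \<ge> l \<Longrightarrow> coeff p k = 0" "i < l"
  shows "(\<Sum>j<l. (if i = j then d else if j = Suc i then s else if i = Suc j then t else 0) * coeff p j)
    = d * coeff p i + s * coeff p (Suc i) + (case i of 0 \<Rightarrow> 0 | Suc m \<Rightarrow> t * coeff p m)"
proof -
  have "(\<Sum>j<l. (if i = j then d else if j = Suc i then s else if i = Suc j then t else 0) * coeff p j)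
    = (\<Sum>j<l. (if j = i then d * coeff p i else 0) + (if j = Suc i then s * coeff p (Suc i) else 0)
        + (case i of 0 \<Rightarrow> 0 | Suc m \<Rightarrow> if j = m then t * coeff p m else 0))"
    by (intro sum.cong) (auto split: nat.splits)
  also have "\<dots> = (\<Sum>j<l. if j = i then d * coeff p i else 0)
      + (\<Sum>j<l. if j = Suc i then s * coeff p (Suc i) else 0)
      + (\<Sum>j<l. case i of 0 \<Rightarrow> 0 | Suc m \<Rightarrow> if j = m then t * coeff p m else 0)"
    by (simp add: sum.distrib)
  \<comment> \<open>In the last row \<open>Suc i = l\<close> lies outside the range of summation,
    but there the coefficient is zero as well.\<close>
  also have "(\<Sum>j<l. if j = Suc i then s * coeff p (Suc i) else 0) = s * coeff p (Suc i)"
    using assms(1)[of "Suc i"] by (auto simp: not_less)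
  finally show ?thesis using assms(2) by (auto split: nat.splits)
qed

lemma char_mat_row_sum:
  assumes "\<And>k. k \<ge> l \<Longrightarrow> coeff p k = 0" "i < l"
  shows "(\<Sum>j<l. char_mat l (lam, \<mu>) $$ (i, j) * coeff p j) = coeff (heun l lam \<mu> p) i"
proof -
  have "(\<Sum>j<l. char_mat l (lam, \<mu>) $$ (i, j) * coeff p j)
    = (\<Sum>j<l. (if i = j then of_nat i * of_nat i - of_nat l * of_nat i + lam
        else if j = Suc i then \<mu> * of_nat (Suc i)
        else if i = Suc j then \<mu> * (of_nat l - of_nat i) else 0) * coeff p j)"
    using assms(2) by (intro sum.cong) (auto simp: char_mat_entry)
  then show ?thesis
    using tridiagonal_row_sum[OF assms] by (simp only: coeff_heun)
qed

text \<open>Without the last row and the first column the superdiagonal becomes the diagonal of a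
  lower triangular matrix, with entries \<mu> (i + 1). This cofactor is the constant coefficient of
  the kernel polynomial constructed below.\<close>

lemma cofactor_char_mat_corner:
  assumes "l \<ge> 1" "\<mu> \<noteq> 0"
  shows "cofactor (char_mat l (lam, \<mu>)) (l - 1) 0 \<noteq> 0"
proof -
  let ?M = "mat_delete (char_mat l (lam, \<mu>)) (l - 1) 0"
  have dims: "dim_row (char_mat l (lam, \<mu>)) = l" "dim_col (char_mat l (lam, \<mu>)) = l"
    using char_mat_carrier[of l "(lam, \<mu>)"] by auto
  note [simp del] = One_nat_def
  have M: "?M \<in> carrier_mat (l - 1) (l - 1)" by (simp add: mat_delete_def dims)
  have entry: "?M $$ (i, j) = char_mat l (lam, \<mu>) $$ (i, Suc j)" if "i < l - 1" "j < l - 1" for i j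
    using that by (simp add: mat_delete_def dims)
  have "det ?M = prod_list (diag_mat ?M)"
    using M by (intro det_lower_triangular) (auto simp: entry char_mat_entry)
  moreover have "0 \<notin> set (diag_mat ?M)"
    using M assms(2) by (auto simp: diag_mat_def entry char_mat_entry simp del: of_nat_Suc)
  ultimately show ?thesis by (simp add: cofactor_def)
qed

lemma spectral_det_char_mat: "spectral_det l z = det (char_mat l z)"
  by (simp add: spectral_det_def char_mat_def split: prod.splits)

lemma complex_differentiable2_char_mat_entry:
  assumes "i < l" "j < l"
  shows "complex_differentiable2 (\<lambda>z. char_mat l z $$ (i, j)) p"
proof -
  have "\<exists>a b c. \<forall>z. char_mat l z $$ (i, j) = a * fst z + b * snd z + c"
  proof (cases "i = j")
    case True
    then show ?thesis using assms
      by (intro exI[of _ 1] exI[of _ 0] exI[of _ "of_nat i * of_nat i - of_nat l * of_nat i"])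
        (simp add: char_mat_entry)
  next
    case False
    then show ?thesis using assms
      by (intro exI[of _ 0] exI[of _ "if j = Suc i then of_nat (Suc i)
          else if i = Suc j then of_nat l - of_nat i else 0"]) (simp add: char_mat_entry)
  qed
  then obtain a b c where eq: "\<And>z. char_mat l z $$ (i, j) = a * fst z + b * snd z + c" by blast
  show ?thesis
    unfolding eq
    by (rule complex_differentiable2_add[OF complex_differentiable2_add[OF
        complex_differentiable2_mult[OF complex_differentiable2_const complex_differentiable2_fst]
        complex_differentiable2_mult[OF complex_differentiable2_const complex_differentiable2_snd]]
        complex_differentiable2_const])
qed

section \<open>The gradient of the determinant on the curve\<close>

lemma spectral_det_gradient_ne_0:
  assumes l: "l \<ge> 1" and \<mu>: "\<mu> \<noteq> 0" and det: "spectral_det l (lam, \<mu>) = 0"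
    and grad: "has_complex_gradient (spectral_det l) (a, b) (lam, \<mu>)"
  shows "(a, b) \<noteq> (0, 0)"
proof
  assume "(a, b) = (0, 0)"
  then have grad0: "has_complex_gradient (\<lambda>z. det (char_mat l z)) (0, 0) (lam, \<mu>)"
    using grad by (simp add: spectral_det_char_mat[abs_def])
  \<comment> \<open>The last column of the adjugate is chosen because its first entry, the corner
    cofactor, is nonzero. The polynomials \<open>P v\<close>, \<open>P C\<close>,
    \<open>P C'\<close> serve as \<open>E\<close>, \<open>u\<close>, \<open>w\<close>.\<close>
  define v where "v = cofactor (char_mat l (lam, \<mu>)) (l - 1)"
  have "\<exists>C C'. has_complex_gradient (\<lambda>z. cofactor (char_mat l z) (l - 1) j) (C, C') (lam, \<mu>)" for j
    using complex_differentiable2_cofactor[where A = "char_mat l" and n = l and p = "(lam, \<mu>)"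
        and k = "l - 1" and m = j, OF char_mat_carrier complex_differentiable2_char_mat_entry]
    unfolding complex_differentiable2_def by auto
  then obtain C C' where C:
    "\<And>j. has_complex_gradient (\<lambda>z. cofactor (char_mat l z) (l - 1) j) (C j, C' j) (lam, \<mu>)"
    by metis
  define P where "P f = (\<Sum>j<l. monom (f j :: complex) j)" for f
  have coeff_P: "coeff (P f) k = (if k < l then f k else 0)" for f k
    unfolding P_def by (simp add: coeff_sum)
  have row: "(\<Sum>j<l. char_mat l (lam, \<mu>) $$ (i, j) * f j) = coeff (heun l lam \<mu> (P f)) i"
    if "i < l" for i f
    using char_mat_row_sum[of l "P f" i lam \<mu>] that by (simp add: coeff_P)
  have poly_eqI: "p = q"
    if "\<And>i. i < l \<Longrightarrow> coeff p i = coeff q i" "\<And>i. i \<ge> l \<Longrightarrow> coeff p i = 0"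
      "\<And>i. i \<ge> l \<Longrightarrow> coeff q i = 0" for p q :: "complex poly"
    using that by (intro poly_eqI) (metis not_le)
  have high: "coeff (heun l lam \<mu> (P f)) i = 0" "coeff (heun_mu l (P f)) i = 0" if "i \<ge> l" for f i
    using that coeff_heun_eq_0[of l "P f"] by (auto simp: coeff_P)

  have E: "heun l lam \<mu> (P v) = 0"
  proof (rule poly_eqI)
    fix i assume i: "i < l"
    have "coeff (heun l lam \<mu> (P v)) i = (char_mat l (lam, \<mu>) * adj_mat (char_mat l (lam, \<mu>))) $$ (i, l - 1)"
      using i char_mat_carrier[of l "(lam, \<mu>)"]
      by (simp add: row[symmetric] scalar_prod_def adj_mat_def lessThan_atLeast0 v_def)
    also have "\<dots> = 0"
      using adj_mat(2)[OF char_mat_carrier[of l "(lam, \<mu>)"]] i det by (simp add: spectral_det_char_mat)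
    finally show "coeff (heun l lam \<mu> (P v)) i = coeff 0 i" by simp
  qed (use high in auto)

  \<comment> \<open>Each matrix entry is affine in \<lambda> and in \<mu> separately.\<close>
  have lin: "((\<lambda>t. d * t + c) has_field_derivative d) (at x)" for c d x :: complex
    by (auto intro!: derivative_eq_intros)

  \<comment> \<open>The \<lambda>-derivative of the matrix is the identity, whence the right-hand
    side.\<close>
  have u: "heun l lam \<mu> (P C) = - P v"
  proof (rule poly_eqI)
    fix i assume i: "i < l"
    have "(\<Sum>j<l. char_mat l (lam, \<mu>) $$ (i, j) * C j) = - (\<Sum>j<l. (if i = j then 1 else 0) * v j)"
      unfolding v_def
    proof (rule deriv_mat_times_cofactor[where A = "\<lambda>t. char_mat l (t, \<mu>)" and x = lam and k = "l - 1"])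
      show "((\<lambda>t. char_mat l (t, \<mu>) $$ (i, j)) has_field_derivative (if i = j then 1 else 0)) (at lam)"
        if "i < l" "j < l" for i j
      proof -
        define c where "c = char_mat l (0, \<mu>) $$ (i, j)"
        have "char_mat l (t, \<mu>) $$ (i, j) = (if i = j then 1 else 0) * t + c" for t
          using that by (simp add: char_mat_entry c_def)
        then show ?thesis
          by (simp only: lin)
      qed
      show "((\<lambda>t. cofactor (char_mat l (t, \<mu>)) (l - 1) j) has_field_derivative C j) (at lam)" for j
        by (rule has_complex_gradientD(1)[OF C])
      show "((\<lambda>t. det (char_mat l (t, \<mu>))) has_field_derivative 0) (at lam)"
        by (rule has_complex_gradientD(1)[OF grad0])
    qed (use i l in \<open>auto intro: char_mat_carrier\<close>)
    also have "(\<Sum>j<l. (if i = j then 1 else 0) * v j) = (\<Sum>j<l. if j = i then v j else 0)"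
      by (intro sum.cong) auto
    finally show "coeff (heun l lam \<mu> (P C)) i = coeff (- P v) i"
      using i by (simp add: row coeff_P)
  qed (use high coeff_P in auto)

  have w: "heun l lam \<mu> (P C') = - heun_mu l (P v)"
  proof (rule poly_eqI)
    fix i assume i: "i < l"
    have "(\<Sum>j<l. char_mat l (lam, \<mu>) $$ (i, j) * C' j)
        = - (\<Sum>j<l. (if i = j then 0 else if j = Suc i then of_nat (Suc i)
           else if i = Suc j then of_nat l - of_nat i else 0) * v j)"
      unfolding v_def
    proof (rule deriv_mat_times_cofactor[where A = "\<lambda>t. char_mat l (lam, t)" and x = \<mu> and k = "l - 1"])
      show "((\<lambda>t. char_mat l (lam, t) $$ (i, j)) has_field_derivative
          (if i = j then 0 else if j = Suc i then of_nat (Suc i)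
           else if i = Suc j then of_nat l - of_nat i else 0)) (at \<mu>)"
        if "i < l" "j < l" for i j
      proof -
        define c where "c = char_mat l (lam, 0) $$ (i, j)"
        have "char_mat l (lam, t) $$ (i, j) = (if i = j then 0 else if j = Suc i then of_nat (Suc i)
           else if i = Suc j then of_nat l - of_nat i else 0) * t + c" for t
          using that by (simp add: char_mat_entry c_def)
        then show ?thesis
          by (simp only: lin)
      qed
      show "((\<lambda>t. cofactor (char_mat l (lam, t)) (l - 1) j) has_field_derivative C' j) (at \<mu>)" for j
        by (rule has_complex_gradientD(2)[OF C])
      show "((\<lambda>t. det (char_mat l (lam, t))) has_field_derivative 0) (at \<mu>)"
        by (rule has_complex_gradientD(2)[OF grad0])
    qed (use i l in \<open>auto intro: char_mat_carrier\<close>)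
    also have "(\<Sum>j<l. (if i = j then 0 else if j = Suc i then of_nat (Suc i)
           else if i = Suc j then of_nat l - of_nat i else 0) * v j) =
        (\<Sum>j<l. (if i = j then 0 else if j = Suc i then of_nat (Suc i)
           else if i = Suc j then of_nat l - of_nat i else 0) * coeff (P v) j)"
      by (intro sum.cong) (auto simp: coeff_P)
    \<comment> \<open>The \<mu>-derivative of the matrix is again tridiagonal, with zero diagonal,
      and acts on coefficients as \<open>heun_mu\<close>.\<close>
    also have "\<dots> = coeff (heun_mu l (P v)) i"
      by (subst tridiagonal_row_sum) (use i in \<open>auto simp: coeff_P coeff_heun_mu split: nat.splits\<close>)
    finally show "coeff (heun l lam \<mu> (P C')) i = coeff (- heun_mu l (P v)) i"
      using i by (simp add: row)
  qed (use high in auto)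

  have "poly (P v) 0 = v 0" using l by (simp add: poly_0_coeff_0 coeff_P)
  then have "poly (P v) 0 \<noteq> 0"
    using cofactor_char_mat_corner[OF l \<mu>] by (simp add: v_def)
  then show False
    using heun_deriv_kernel_contradiction[OF \<mu> l E _ _ u _ w] by (simp add: coeff_P)
qed

theorem theorem1p6:
  fixes l :: nat
  assumes "l \<ge> 1"
  shows "smooth_complex_curve (spectral_curve_o l) \<and>
    (\<forall>p \<in> spectral_curve_o l. nonsingular_at (spectral_det l) p)"
proof
  have diff: "complex_differentiable2 (spectral_det l) p" for p
    unfolding spectral_det_char_mat[abs_def]
    by (intro complex_differentiable2_det[where n = l] char_mat_carrier
        complex_differentiable2_char_mat_entry)
  show nonsing: "\<forall>p \<in> spectral_curve_o l. nonsingular_at (spectral_det l) p"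
  proof
    fix p assume p: "p \<in> spectral_curve_o l"
    obtain lam \<mu> where [simp]: "p = (lam, \<mu>)" by (cases p)
    obtain a b where g: "has_complex_gradient (spectral_det l) (a, b) p"
      using diff[of p] unfolding complex_differentiable2_def by auto
    have "(a, b) \<noteq> (0, 0)"
      using p g by (intro spectral_det_gradient_ne_0[OF assms])
        (auto simp: spectral_curve_o_def spectral_curve_def)
    then show "nonsingular_at (spectral_det l) p"
      using g unfolding nonsingular_at_def by blast
  qed
  show "smooth_complex_curve (spectral_curve_o l)"
    unfolding smooth_complex_curve_def
  proof
    fix p assume p: "p \<in> spectral_curve_o l"
    \<comment> \<open>The complement of the line \<mu> = 0 is open, and on it the determinant is a
      defining function for every point at once.\<close>
    let ?U = "UNIV \<times> (- {0}) :: (complex \<times> complex) set"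
    have "open ?U" by (intro open_Times) auto
    then have "holomorphic2_on (spectral_det l) ?U"
      using diff unfolding holomorphic2_on_def complex_differentiable2_def by auto
    moreover have "p \<in> ?U" "spectral_curve_o l \<inter> ?U = {z \<in> ?U. spectral_det l z = 0}"
      using p by (auto simp: spectral_curve_o_def spectral_curve_def)
    ultimately show "\<exists>U f. p \<in> U \<and> holomorphic2_on f U \<and> nonsingular_at f p \<and>
        spectral_curve_o l \<inter> U = {z \<in> U. f z = 0}"
      using nonsing p by (intro exI[of _ ?U] exI[of _ "spectral_det l"] conjI) simp_all
  qed
qed

end
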